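(* Let $\varphi$ be a state on $\mathfrak{A}=\mathrm{CCR}(\mathbb{C},\sigma)$ and $G_\varphi(z)=\varphi(W(z))$, $z\in\mathbb{C}$. If $\omega=\otimes_{\mathbb{Z}}\varphi$ is a $\mathbb{U}_{\mathbb{Z}}$-invariant state on $\mathfrak{B}_0$, then either $G_\varphi=\mathbf{1}_{\{0\}}$ (the indicator function of $\{0\}\subset\mathbb{C}$) or $$G_\varphi(z)=e^{-\frac{\sigma^2|z|^2}{2}},\qquad z\in\mathbb{C},$$ where $\sigma^2$ is a constant with $\sigma^2\ge1$.
   Context: $\mathcal{H}$ is an infinite-dimensional separable complex Hilbert space (inner product linear in the first variable) with a fixed orthonormal basis $\{e_k:k\in\mathbb{Z}\}$, and symplectic form $\sigma(x,y)=\mathrm{Im}\langle x,y\rangle$ (the constant $\sigma^2$ in the claim is unrelated to this form). $\mathrm{CCR}(\mathcal{H},\sigma)$ is the universal $C^*$-algebra generated by elements $W(x)$, $x\in\mathcal{H}$, with $W(x)^*=W(-x)$ and $W(x)W(y)=e^{i\sigma(x,y)}W(x+y)$. $\mathcal{H}_0$ is the (algebraic) linear span of $\{e_k\}$, and $\mathfrak{B}_0$ is the $C^*$-subalgebra generated by $\{W(x):x\in\mathcal{H}_0\}$. $\mathfrak{A}=\mathrm{CCR}(\mathbb{C},\sigma)$ is the analogous algebra for $\mathbb{C}$ with $\sigma(z,w)=\mathrm{Im}\, z\bar w$. For $k\in\mathbb{Z}$, $i_k:\mathfrak{A}\to\mathfrak{B}_0$ is the embedding with $i_k(W(z))=W(ze_k)$;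 through these $\mathfrak{B}_0\cong\bigotimes_{\mathbb{Z}}\mathfrak{A}$, and $\otimes_{\mathbb{Z}}\varphi$ is the product state determined by $(\otimes_{\mathbb{Z}}\varphi)(i_{k_1}(a_1)\cdots i_{k_n}(a_n))=\varphi(a_1)\cdots\varphi(a_n)$ for distinct $k_1,\dots,k_n\in\mathbb{Z}$ and $a_1,\dots,a_n\in\mathfrak{A}$. $\mathbb{U}_{\mathbb{Z}}$ is the group of unitaries $U$ on $\mathcal{H}$ for which there is $N>0$ with $Ue_i=e_i$ for all $|i|>N$; it acts on $\mathfrak{B}_0$ by the automorphisms $\rho_U(W(x))=W(Ux)$. A state $\omega$ is $\mathbb{U}_{\mathbb{Z}}$-invariant if $\omega\circ\rho_U=\omega$ for all $U\in\mathbb{U}_{\mathbb{Z}}$. *)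

theory Defs
  imports "HOL-Analysis.Analysis" "HOL-Algebra.Algebraic_Closure_Type"
begin

section \<open>Complex Hilbert spaces\<close>

text \<open>The real structure is the underlying one, so \<open>inner\<close> is the real part of the complex inner
  product, and norm, metric and topology are the usual ones. \<open>cinner\<close> is linear in the first
  argument.\<close>

class complex_inner = real_inner +
  fixes scaleC :: "complex \<Rightarrow> 'a \<Rightarrow> 'a" (infixr \<open>*\<^sub>C\<close> 75)
    and cinner :: "'a \<Rightarrow> 'a \<Rightarrow> complex"
  assumes scaleC_add_right: "c *\<^sub>C (x + y) = c *\<^sub>C x + c *\<^sub>C y"
    and scaleC_add_left: "(c + d) *\<^sub>C x = c *\<^sub>C x + d *\<^sub>C x"
    and scaleC_scaleC: "c *\<^sub>C (d *\<^sub>C x) = (c * d) *\<^sub>C x"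
    and scaleR_scaleC: "r *\<^sub>R x = complex_of_real r *\<^sub>C x"
    and cinner_commute: "cinner x y = cnj (cinner y x)"
    and cinner_add_left: "cinner (x + y) z = cinner x z + cinner y z"
    and cinner_scaleC_left: "cinner (c *\<^sub>C x) y = c * cinner x y"
    and inner_eq_Re_cinner: "inner x y = Re (cinner x y)"

class complex_hilbert = complex_inner + complete_space

instantiation complex :: complex_hilbert
begin

definition scaleC_complex :: "complex \<Rightarrow> complex \<Rightarrow> complex"
  where "scaleC_complex c z = c * z"

definition cinner_complex :: "complex \<Rightarrow> complex \<Rightarrow> complex"
  where "cinner_complex z w = z * cnj w"

instance
  by standard
    (auto simp: scaleC_complex_def cinner_complex_def algebra_simps inner_complex_def
      scaleR_conv_of_real)

end

global_interpretation complex_vector: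
  vector_space "scaleC :: complex \<Rightarrow> 'a \<Rightarrow> 'a::complex_inner"
proof
  show "1 *\<^sub>C x = x" for x :: 'a
    using scaleR_scaleC[of 1 x] by simp
qed (simp_all add: scaleC_add_right scaleC_add_left scaleC_scaleC)

definition symp :: "'h::complex_inner \<Rightarrow> 'h \<Rightarrow> real"
  where "symp x y = Im (cinner x y)"

definition orthonormal_basis :: "('i \<Rightarrow> 'h::complex_hilbert) \<Rightarrow> bool"
  where "orthonormal_basis e \<longleftrightarrow>
    (\<forall>j k. cinner (e j) (e k) = (if j = k then 1 else 0)) \<and>
    closure (complex_vector.span (range e)) = UNIV"

definition unitary_op :: "('h::complex_hilbert \<Rightarrow> 'h) \<Rightarrow> bool"
  where "unitary_op U \<longleftrightarrow>
    Vector_Spaces.linear scaleC scaleC U \<and> surj U \<and> (\<forall>x y. cinner (U x) (U y) = cinner x y)"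

definition finite_unitaries :: "(int \<Rightarrow> 'h::complex_hilbert) \<Rightarrow> ('h \<Rightarrow> 'h) set"
  where "finite_unitaries e =
    {U. unitary_op U \<and> (\<exists>N>0. \<forall>i. \<bar>i\<bar> > N \<longrightarrow> U (e i) = e i)}"

section \<open>C*-algebras\<close>

record 'a cstar_struct = "(complex, 'a) module" +
  adj :: "'a \<Rightarrow> 'a"
  anorm :: "'a \<Rightarrow> real"

text \<open>The guard makes this a metric in the sense of \<open>Metric_space\<close>, which constrains the
  distance function also outside the carrier.\<close>

definition adist :: "'a cstar_struct \<Rightarrow> 'a \<Rightarrow> 'a \<Rightarrow> real"
  where "adist A a b = (if a \<in> carrier A \<and> b \<in> carrier A then anorm A (a \<ominus>\<^bsub>A\<^esub> b) else 0)"

locale cstar_algebra =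
  Ring.ring A + scal: Module.module "ring_of_type_algebra :: complex ring" A
  for A :: "'a cstar_struct" (structure) +
  assumes smult_mult_left: "\<lbrakk>a \<in> carrier A; b \<in> carrier A\<rbrakk> \<Longrightarrow> (c \<odot> a) \<otimes> b = c \<odot> (a \<otimes> b)"
    and smult_mult_right: "\<lbrakk>a \<in> carrier A; b \<in> carrier A\<rbrakk> \<Longrightarrow> a \<otimes> (c \<odot> b) = c \<odot> (a \<otimes> b)"
    and adj_closed: "a \<in> carrier A \<Longrightarrow> adj A a \<in> carrier A"
    and adj_adj: "a \<in> carrier A \<Longrightarrow> adj A (adj A a) = a"
    and adj_add: "\<lbrakk>a \<in> carrier A; b \<in> carrier A\<rbrakk> \<Longrightarrow> adj A (a \<oplus> b) = adj A a \<oplus> adj A b"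
    and adj_smult: "a \<in> carrier A \<Longrightarrow> adj A (c \<odot> a) = cnj c \<odot> adj A a"
    and adj_mult: "\<lbrakk>a \<in> carrier A; b \<in> carrier A\<rbrakk> \<Longrightarrow> adj A (a \<otimes> b) = adj A b \<otimes> adj A a"
    and anorm_nonneg: "a \<in> carrier A \<Longrightarrow> 0 \<le> anorm A a"
    and anorm_eq_0: "a \<in> carrier A \<Longrightarrow> anorm A a = 0 \<longleftrightarrow> a = \<zero>"
    and anorm_triangle: "\<lbrakk>a \<in> carrier A; b \<in> carrier A\<rbrakk> \<Longrightarrow> anorm A (a \<oplus> b) \<le> anorm A a + anorm A b"
    and anorm_smult: "a \<in> carrier A \<Longrightarrow> anorm A (c \<odot> a) = cmod c * anorm A a"
    and anorm_mult: "\<lbrakk>a \<in> carrier A; b \<in> carrier A\<rbrakk> \<Longrightarrow> anorm A (a \<otimes> b) \<le> anorm A a * anorm A b"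
    and cstar_identity: "a \<in> carrier A \<Longrightarrow> anorm A (adj A a \<otimes> a) = (anorm A a)\<^sup>2"
    and complete: "Metric_space.mcomplete (carrier A) (adist A)"

sublocale cstar_algebra \<subseteq> Metric_space "carrier A" "adist A"
proof
  have module_neg: "\<ominus> a = (- 1) \<odot> a" if a: "a \<in> carrier A" for a
  proof -
    have cl: "c \<odot> a \<in> carrier A" for c
      using a scal.smult_closed[of c a] by (simp add: ring_of_type_algebra_def)
    have "a \<oplus> (- 1) \<odot> a = (1 + (- 1)) \<odot> a"
      using a scal.smult_l_distr[of 1 "- 1" a] scal.smult_one[of a]
      by (simp add: ring_of_type_algebra_def)
    also have "\<dots> = \<zero>"
      using anorm_smult[OF a, of 0] anorm_eq_0[OF cl, of 0] by simp
    finally have "a \<oplus> (- 1) \<odot> a = \<zero>" .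
    then show ?thesis
      using a cl minus_equality[of "(- 1) \<odot> a" a] a_comm[of a "(- 1) \<odot> a"] by simp
  qed
  have minus: "anorm A (\<ominus> a) = anorm A a" if "a \<in> carrier A" for a
    using that anorm_smult[of a "- 1"] module_neg by simp
  show "0 \<le> adist A a b" for a b
    by (simp add: adist_def anorm_nonneg)
  show "adist A a b = adist A b a" for a b
  proof -
    have "\<ominus> (a \<ominus> b) = b \<ominus> a" if "a \<in> carrier A" "b \<in> carrier A"
      using that by (simp add: a_minus_def minus_add minus_minus a_comm)
    then show ?thesis
      using minus[of "a \<ominus> b"] by (auto simp: adist_def)
  qed
  show "adist A a b = 0 \<longleftrightarrow> a = b" if "a \<in> carrier A" "b \<in> carrier A" for a b
    using that by (simp add: adist_def anorm_eq_0)
  show "adist A a c \<le> adist A a b + adist A b c"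
    if "a \<in> carrier A" "b \<in> carrier A" "c \<in> carrier A" for a b c
  proof -
    have "(a \<ominus> b) \<oplus> (b \<ominus> c) = a \<oplus> ((\<ominus> b \<oplus> b) \<oplus> \<ominus> c)"
      using that by (simp only: a_minus_def a_assoc a_closed a_inv_closed)
    also have "\<dots> = a \<ominus> c"
      using that by (simp add: a_minus_def l_neg)
    finally have "a \<ominus> c = (a \<ominus> b) \<oplus> (b \<ominus> c)" ..
    then show ?thesis
      using that anorm_triangle[of "a \<ominus> b" "b \<ominus> c"] by (simp add: adist_def)
  qed
qed

text \<open>Subalgebras and homomorphisms are not required to be unital.\<close>

definition cstar_subalgebra :: "'a cstar_struct \<Rightarrow> 'a set \<Rightarrow> bool"
  where "cstar_subalgebra A S \<longleftrightarrow>
    S \<subseteq> carrier A \<and> \<zero>\<^bsub>A\<^esub> \<in> S \<and>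
    (\<forall>a\<in>S. \<forall>b\<in>S. a \<oplus>\<^bsub>A\<^esub> b \<in> S \<and> a \<otimes>\<^bsub>A\<^esub> b \<in> S) \<and>
    (\<forall>a\<in>S. adj A a \<in> S \<and> (\<forall>c. c \<odot>\<^bsub>A\<^esub> a \<in> S)) \<and>
    closedin (Metric_space.mtopology (carrier A) (adist A)) S"

definition cstar_generated :: "'a cstar_struct \<Rightarrow> 'a set \<Rightarrow> 'a set"
  where "cstar_generated A G = \<Inter>{S. cstar_subalgebra A S \<and> G \<subseteq> S}"

definition star_hom :: "'a cstar_struct \<Rightarrow> 'b cstar_struct \<Rightarrow> ('a \<Rightarrow> 'b) \<Rightarrow> bool"
  where "star_hom A B \<pi> \<longleftrightarrow>
    \<pi> \<in> carrier A \<rightarrow> carrier B \<and>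
    (\<forall>a\<in>carrier A. \<forall>b\<in>carrier A.
       \<pi> (a \<oplus>\<^bsub>A\<^esub> b) = \<pi> a \<oplus>\<^bsub>B\<^esub> \<pi> b \<and> \<pi> (a \<otimes>\<^bsub>A\<^esub> b) = \<pi> a \<otimes>\<^bsub>B\<^esub> \<pi> b) \<and>
    (\<forall>a\<in>carrier A. \<pi> (adj A a) = adj B (\<pi> a) \<and> (\<forall>c. \<pi> (c \<odot>\<^bsub>A\<^esub> a) = c \<odot>\<^bsub>B\<^esub> \<pi> a))"

definition state :: "'a cstar_struct \<Rightarrow> ('a \<Rightarrow> complex) \<Rightarrow> bool"
  where "state A \<phi> \<longleftrightarrow>
    (\<forall>a\<in>carrier A. \<forall>b\<in>carrier A. \<phi> (a \<oplus>\<^bsub>A\<^esub> b) = \<phi> a + \<phi> b) \<and>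
    (\<forall>a\<in>carrier A. \<forall>c. \<phi> (c \<odot>\<^bsub>A\<^esub> a) = c * \<phi> a) \<and>
    (\<forall>a\<in>carrier A. \<phi> (adj A a \<otimes>\<^bsub>A\<^esub> a) \<in> \<real>\<^sub>\<ge>\<^sub>0) \<and>
    \<phi> \<one>\<^bsub>A\<^esub> = 1"

section \<open>The CCR algebra\<close>

definition ccr_relations :: "'a cstar_struct \<Rightarrow> ('h::complex_inner \<Rightarrow> 'a) \<Rightarrow> bool"
  where "ccr_relations A W \<longleftrightarrow>
    range W \<subseteq> carrier A \<and>
    (\<forall>x. adj A (W x) = W (- x)) \<and>
    (\<forall>x y. W x \<otimes>\<^bsub>A\<^esub> W y = exp (\<i> * of_real (symp x y)) \<odot>\<^bsub>A\<^esub> W (x + y))"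

text \<open>\<open>is_CCR A W\<close>: the pair \<open>(A, W)\<close> is a model of the universal C*-algebra CCR(H, \<open>\<sigma>\<close>), which is
  unique up to isomorphism. The homomorphism in the universal property is unique because the
  \<open>W x\<close> generate \<open>A\<close>.

  HOL cannot quantify over the carrier type of the test algebra \<open>B\<close>, but
  \<^typ>\<open>'h \<Rightarrow> complex\<close> is large enough to give the full universal property: the C*-subalgebra
  generated by elements \<open>V x\<close> of any C*-algebra has at most
  \<open>|'h \<Rightarrow> complex|\<close> elements, so it has a copy whose carrier lies in this type. The relations force
  \<open>W 0\<close> to be the unit of the algebra generated by the \<open>W x\<close>; in a test algebra \<open>V 0\<close> may be a
  proper projection, which is why \<open>\<pi>\<close> is not required to be unital.\<close>

definition is_CCR :: "'a cstar_struct \<Rightarrow> ('h::complex_inner \<Rightarrow> 'a) \<Rightarrow> bool"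
  where "is_CCR A W \<longleftrightarrow>
    cstar_algebra A \<and> ccr_relations A W \<and> cstar_generated A (range W) = carrier A \<and>
    (\<forall>(B :: ('h \<Rightarrow> complex) cstar_struct) V. cstar_algebra B \<and> ccr_relations B V \<longrightarrow>
       (\<exists>\<pi>. star_hom A B \<pi> \<and> (\<forall>x. \<pi> (W x) = V x)))"

text \<open>In the following, \<open>(B, W)\<close> is a model of CCR(H, \<open>\<sigma>\<close>), \<open>(A, V)\<close> one of CCR(\<open>\<complex>\<close>, \<open>\<sigma>\<close>), and
  \<open>e\<close> an orthonormal basis of H.\<close>

definition local_alg ::
  "'b cstar_struct \<Rightarrow> ('h::complex_hilbert \<Rightarrow> 'b) \<Rightarrow> (int \<Rightarrow> 'h) \<Rightarrow> 'b cstar_struct"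
  where "local_alg B W e =
    B\<lparr>carrier := cstar_generated B (W ` complex_vector.span (range e))\<rparr>"

definition site_embedding ::
  "'a cstar_struct \<Rightarrow> (complex \<Rightarrow> 'a) \<Rightarrow> 'b cstar_struct \<Rightarrow> ('h::complex_hilbert \<Rightarrow> 'b) \<Rightarrow>
    (int \<Rightarrow> 'h) \<Rightarrow> int \<Rightarrow> ('a \<Rightarrow> 'b) \<Rightarrow> bool"
  where "site_embedding A V B W e k \<iota> \<longleftrightarrow>
    star_hom A (local_alg B W e) \<iota> \<and> inj_on \<iota> (carrier A) \<and> (\<forall>z. \<iota> (V z) = W (z *\<^sub>C e k))"

definition second_quantised ::
  "'b cstar_struct \<Rightarrow> ('h::complex_hilbert \<Rightarrow> 'b) \<Rightarrow> (int \<Rightarrow> 'h) \<Rightarrow> ('h \<Rightarrow> 'h) \<Rightarrow> ('b \<Rightarrow> 'b) \<Rightarrow> bool"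
  where "second_quantised B W e U \<rho> \<longleftrightarrow>
    star_hom (local_alg B W e) (local_alg B W e) \<rho> \<and>
    bij_betw \<rho> (carrier (local_alg B W e)) (carrier (local_alg B W e)) \<and>
    (\<forall>x\<in>complex_vector.span (range e). \<rho> (W x) = W (U x))"

definition product_state ::
  "'a cstar_struct \<Rightarrow> 'b cstar_struct \<Rightarrow> (int \<Rightarrow> 'a \<Rightarrow> 'b) \<Rightarrow> ('a \<Rightarrow> complex) \<Rightarrow> ('b \<Rightarrow> complex) \<Rightarrow> bool"
  where "product_state A B0 \<iota> \<phi> \<omega> \<longleftrightarrow>
    state B0 \<omega> \<and>
    (\<forall>ks a. distinct ks \<and> (\<forall>k\<in>set ks. a k \<in> carrier A) \<longrightarrow>
       \<omega> (foldr (\<lambda>k b. \<iota> k (a k) \<otimes>\<^bsub>B0\<^esub> b) ks \<one>\<^bsub>B0\<^esub>) = (\<Prod>k\<leftarrow>ks. \<phi> (a k)))"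

end

theory Submission
  imports Defs
begin

text \<open>Invariance under the phase \<open>e\<^sub>0 \<mapsto> u e\<^sub>0\<close> makes \<open>G\<^sub>\<phi>\<close> radial, and a reflection mapping \<open>e\<^sub>0\<close> to
  \<open>cos t e\<^sub>0 + sin t e\<^sub>1\<close> gives \<open>G\<^sub>\<phi>(z) = G\<^sub>\<phi>(cos t z) G\<^sub>\<phi>(sin t z)\<close>. Hence
  \<open>g(t) = G\<^sub>\<phi>(\<surd>t)\<close> is multiplicative with values in \<open>[0, 1]\<close>: either it vanishes for \<open>t > 0\<close> or it
  equals \<open>exp(- c t)\<close>. In the second case positivity of \<open>\<phi>\<close> on \<open>a\<^sup>* a\<close> with
  \<open>a = \<Sum>j<4. \<i>^j W(\<i>^j r)\<close> reads
  \<open>1 - exp(- 4 c r\<^sup>2) \<ge> 2 exp(- 2 c r\<^sup>2) sin(r\<^sup>2)\<close>, and letting \<open>r \<rightarrow> 0\<close> yields \<open>2 c \<ge> 1\<close>.\<close>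

section \<open>Closedness, unit and positivity in a CCR algebra\<close>

context cstar_algebra
begin

lemma scal_closed: "a \<in> carrier A \<Longrightarrow> c \<odot> a \<in> carrier A"
  using scal.smult_closed[of c a] by (simp add: ring_of_type_algebra_def)

lemma scal_one: "a \<in> carrier A \<Longrightarrow> 1 \<odot> a = a"
  using scal.smult_one[of a] by (simp add: ring_of_type_algebra_def)

lemma scal_0_left: "a \<in> carrier A \<Longrightarrow> 0 \<odot> a = \<zero>"
  using anorm_smult[of a 0] anorm_eq_0[of "0 \<odot> a"] scal_closed[of a 0] by simp

lemma adj_zero: "adj A \<zero> = \<zero>"
  using adj_smult[of \<zero> 0] by (simp add: scal_0_left adj_closed)

text \<open>If \<open>b\<close> is fixed, then the distance from \<open>f a\<close> to
  \<open>a\<close> is at most \<open>K + 1\<close> times that from \<open>a\<close> to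
  \<open>b\<close>. So a ball of radius \<open>?r\<close> around a non-fixed \<open>a\<close>
  contains no fixed point. It serves for left and right multiplication by
  \<open>V 0\<close>.\<close>

lemma closedin_fixed_points:
  assumes lin: "\<And>a b. a \<in> carrier A \<Longrightarrow> b \<in> carrier A \<Longrightarrow> f (a \<ominus> b) = f a \<ominus> f b"
    and cl: "\<And>a. a \<in> carrier A \<Longrightarrow> f a \<in> carrier A"
    and bd: "\<And>a. a \<in> carrier A \<Longrightarrow> anorm A (f a) \<le> K * anorm A a" and K: "K \<ge> 0"
  shows "closedin mtopology {a \<in> carrier A. f a = a}"
  unfolding closedin_metric
proof (intro conjI allI impI)
  fix a assume a: "a \<in> carrier A - {a \<in> carrier A. f a = a}"
  let ?d = "adist A (f a) a"
  let ?r = "?d / (K + 1)"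
  have d: "?d > 0"
    using a cl[of a] mdist_pos_eq by auto
  have "adist A a b \<ge> ?r" if b: "b \<in> carrier A" "f b = b" for b
  proof -
    have "?d \<le> adist A (f a) (f b) + adist A b a"
      using a b cl triangle by auto
    also have "adist A (f a) (f b) \<le> K * adist A a b"
      using a b lin[of a b] bd[of "a \<ominus> b"] cl by (auto simp: adist_def)
    finally show ?thesis
      using K by (simp add: field_simps commute)
  qed
  then show "\<exists>r>0. disjnt {a \<in> carrier A. f a = a} (mball a r)"
    using d K by (intro exI[of _ ?r]) (force simp: disjnt_iff)
qed auto

end

text \<open>The elements on which \<open>V 0\<close> acts as a two-sided unit form a C*-subalgebra
  containing every \<open>V x\<close>, hence are everything, the unit included. Both sides are
  treated together because the adjoint exchanges \<open>?L\<close> and \<open>?R\<close>.\<close>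

lemma CCR_unit:
  assumes "is_CCR A V"
  shows "V 0 = \<one>\<^bsub>A\<^esub>"
proof -
  interpret cstar_algebra A
    using assms by (simp add: is_CCR_def)
  have rel: "V x \<in> carrier A" "adj A (V x) = V (- x)"
    "V x \<otimes>\<^bsub>A\<^esub> V y = exp (\<i> * of_real (symp x y)) \<odot>\<^bsub>A\<^esub> V (x + y)" for x y
    using assms by (auto simp: is_CCR_def ccr_relations_def)
  have zero: "symp 0 x = 0" "symp x 0 = 0" for x :: 'b
    using cinner_scaleC_left[of 0 0 x] cinner_commute[of x 0]
    by (auto simp: symp_def complex_vector.scale_zero_left)
  have V0: "V 0 \<otimes>\<^bsub>A\<^esub> V x = V x" "V x \<otimes>\<^bsub>A\<^esub> V 0 = V x" for x
    by (simp_all add: rel zero scal_one)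
  let ?L = "{a \<in> carrier A. V 0 \<otimes>\<^bsub>A\<^esub> a = a}"
  let ?R = "{a \<in> carrier A. a \<otimes>\<^bsub>A\<^esub> V 0 = a}"
  have "closedin mtopology ?L" "closedin mtopology ?R"
    by (rule closedin_fixed_points[where K = "anorm A (V 0)"];
        simp add: rel a_minus_def r_distr r_minus anorm_mult anorm_nonneg)
      (rule closedin_fixed_points[where K = "anorm A (V 0)"];
        simp add: rel a_minus_def l_distr l_minus anorm_nonneg
          order.trans[OF anorm_mult] mult.commute)
  then have "closedin mtopology (?L \<inter> ?R)"
    by (rule closedin_Int)
  moreover have "adj A a \<in> ?L \<inter> ?R" if "a \<in> ?L \<inter> ?R" for a
    using that adj_mult[of a "V 0"] adj_mult[of "V 0" a] by (simp add: rel adj_closed)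
  moreover have "a \<otimes>\<^bsub>A\<^esub> b \<in> ?L \<inter> ?R" if "a \<in> ?L \<inter> ?R" "b \<in> ?L \<inter> ?R" for a b
    using that m_assoc[of "V 0" a b] m_assoc[of a b "V 0"] by (simp add: rel(1))
  moreover have "a \<oplus>\<^bsub>A\<^esub> b \<in> ?L \<inter> ?R" "c \<odot>\<^bsub>A\<^esub> a \<in> ?L \<inter> ?R" "\<zero>\<^bsub>A\<^esub> \<in> ?L \<inter> ?R"
    if "a \<in> ?L \<inter> ?R" "b \<in> ?L \<inter> ?R" for a b c
    using that
    by (simp_all add: rel(1) r_distr l_distr smult_mult_left smult_mult_right scal_closed)
  ultimately have "cstar_subalgebra A (?L \<inter> ?R)"
    unfolding cstar_subalgebra_def by (intro conjI ballI allI) (auto simp: rel(1))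
  moreover have "range V \<subseteq> ?L \<inter> ?R"
    by (auto simp: rel(1) V0)
  ultimately have "cstar_generated A (range V) \<subseteq> ?L \<inter> ?R"
    unfolding cstar_generated_def by (intro Inter_lower CollectI conjI)
  then have "\<one>\<^bsub>A\<^esub> \<in> ?L"
    using assms by (auto simp: is_CCR_def)
  then show ?thesis
    by (simp add: rel)
qed

text \<open>The double sum is the value of \<open>\<phi>\<close> at the product of the adjoint of
  \<open>a\<close> with \<open>a\<close>, where \<open>a\<close> is the linear combination of Weyl
  elements listed in \<open>l\<close>, expanded by the Weyl relations.\<close>

lemma CCR_positive:
  fixes l :: "(complex \<times> 'h::complex_inner) list"
  assumes "cstar_algebra A" and "ccr_relations A V" and \<phi>: "state A \<phi>"
  shows "(\<Sum>(c, x)\<leftarrow>l. \<Sum>(d, y)\<leftarrow>l.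
    cnj c * d * exp (\<i> * of_real (symp (- x) y)) * \<phi> (V (y - x))) \<in> \<real>\<^sub>\<ge>\<^sub>0"
proof -
  interpret cstar_algebra A by fact
  have rel: "V x \<in> carrier A" "adj A (V x) = V (- x)"
    "V x \<otimes>\<^bsub>A\<^esub> V y = exp (\<i> * of_real (symp x y)) \<odot>\<^bsub>A\<^esub> V (x + y)" for x y
    using assms by (auto simp: ccr_relations_def)
  have \<phi>_add: "\<phi> (a \<oplus>\<^bsub>A\<^esub> b) = \<phi> a + \<phi> b" if "a \<in> carrier A" "b \<in> carrier A" for a b
    using \<phi> that by (simp add: state_def)
  have \<phi>_scal: "\<phi> (c \<odot>\<^bsub>A\<^esub> a) = c * \<phi> a" if "a \<in> carrier A" for a c
    using \<phi> that by (simp add: state_def)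
  have \<phi>_zero: "\<phi> \<zero>\<^bsub>A\<^esub> = 0"
    using \<phi>_add[of "\<zero>\<^bsub>A\<^esub>" "\<zero>\<^bsub>A\<^esub>"] by simp
  define comb where "comb l = foldr (\<lambda>(c, x) a. c \<odot>\<^bsub>A\<^esub> V x \<oplus>\<^bsub>A\<^esub> a) l \<zero>\<^bsub>A\<^esub>" for l
  have comb_simps: "comb [] = \<zero>\<^bsub>A\<^esub>" "comb ((c, x) # l) = c \<odot>\<^bsub>A\<^esub> V x \<oplus>\<^bsub>A\<^esub> comb l" for c x l
    by (simp_all add: comb_def)
  have cl: "comb l \<in> carrier A" for l
    by (induction l) (auto simp: comb_simps rel scal_closed)
  have right: "\<phi> (V x \<otimes>\<^bsub>A\<^esub> comb l) =
      (\<Sum>(d, y)\<leftarrow>l. d * exp (\<i> * of_real (symp x y)) * \<phi> (V (x + y)))" for x l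
    by (induction l)
      (auto simp: comb_simps \<phi>_zero rel cl scal_closed r_distr \<phi>_add \<phi>_scal smult_mult_right)
  \<comment> \<open>Two independent lists, so that the induction on the left factor keeps the right
    one fixed; the claim is the diagonal case.\<close>
  have "\<phi> (adj A (comb l) \<otimes>\<^bsub>A\<^esub> comb m) = (\<Sum>(c, x)\<leftarrow>l. \<Sum>(d, y)\<leftarrow>m.
    cnj c * d * exp (\<i> * of_real (symp (- x) y)) * \<phi> (V (y - x)))" for l m
  proof (induction l)
    case Nil
    then show ?case by (simp add: comb_simps adj_zero cl \<phi>_zero)
  next
    case (Cons p l)
    obtain c x where p: "p = (c, x)" by force
    have "\<phi> (adj A (comb (p # l)) \<otimes>\<^bsub>A\<^esub> comb m) =
        cnj c * \<phi> (V (- x) \<otimes>\<^bsub>A\<^esub> comb m) + \<phi> (adj A (comb l) \<otimes>\<^bsub>A\<^esub> comb m)"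
      by (simp add: p comb_simps adj_add adj_smult rel cl scal_closed adj_closed l_distr
          smult_mult_left \<phi>_add \<phi>_scal)
    also have "cnj c * \<phi> (V (- x) \<otimes>\<^bsub>A\<^esub> comb m) = (\<Sum>(d, y)\<leftarrow>m.
        cnj c * d * exp (\<i> * of_real (symp (- x) y)) * \<phi> (V (y - x)))"
      unfolding right by (simp add: sum_list_const_mult[symmetric] case_prod_unfold mult.assoc)
    finally show ?case
      by (simp add: Cons.IH p)
  qed
  from this[of l l] show ?thesis
    using \<phi> cl[of l] unfolding state_def by metis
qed

section \<open>Unitaries acting along one direction\<close>

lemma cinner_add_right: "cinner x (y + z) = cinner x y + cinner x z"
  by (metis cinner_add_left cinner_commute complex_cnj_add)

lemma cinner_scaleC_right: "cinner x (c *\<^sub>C y) = cnj c * cinner x y"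
  by (metis cinner_commute cinner_scaleC_left complex_cnj_mult)

text \<open>For a unit vector \<open>f\<close> this multiplies the component along \<open>f\<close>
  by \<open>u\<close> and fixes the orthogonal complement: a phase rotation in general, the
  Householder reflection for \<open>u = - 1\<close>.\<close>

definition reflection :: "complex \<Rightarrow> 'h::complex_inner \<Rightarrow> 'h \<Rightarrow> 'h"
  where "reflection u f x = x + ((u - 1) * cinner x f) *\<^sub>C f"

text \<open>With \<open>v = u - 1\<close>, inner products change by a multiple of |1 + v|^2 - 1 = 0.
  The conjugate phase gives the inverse, hence surjectivity.\<close>

lemma unitary_reflection:
  assumes f: "cinner f f = 1" and u: "cmod u = 1"
  shows "unitary_op (reflection u f)"
  unfolding unitary_op_def
proof (intro conjI allI)
  have uu: "u * cnj u = 1"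
    using u by (simp add: complex_norm_square[symmetric])
  show "Vector_Spaces.linear scaleC scaleC (reflection u f)"
    by unfold_locales
      (simp_all add: reflection_def cinner_add_left cinner_scaleC_left scaleC_add_left
        scaleC_add_right scaleC_scaleC algebra_simps)
  have "reflection u f (reflection (cnj u) f x) = x" for x
  proof -
    have "(cnj u - 1) * cinner x f +
        (u - 1) * (cinner x f + (cnj u - 1) * cinner x f * cinner f f) = 0"
      using uu f by (simp add: algebra_simps)
    then show ?thesis
      by (simp add: reflection_def cinner_add_left cinner_scaleC_left add.assoc
          flip: scaleC_add_left)
  qed
  then show "surj (reflection u f)"
    by (metis surjI)
  show "cinner (reflection u f x) (reflection u f y) = cinner x y" for x y
  proof -
    define v where "v = u - 1"
    have "cinner (reflection u f x) (reflection u f y) =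
        cinner x y + (v + cnj v + v * cnj v) * (cinner x f * cinner f y)"
      unfolding reflection_def v_def[symmetric]
      by (simp add: cinner_add_left cinner_add_right cinner_scaleC_left
          cinner_scaleC_right f cinner_commute[of f y] ring_distribs)
    moreover have "v + cnj v + v * cnj v = 0"
      using uu by (simp add: v_def algebra_simps)
    ultimately show ?thesis
      by simp
  qed
qed

section \<open>The multiplicative functional equation\<close>

lemma multiplicative_bounded:
  fixes g :: "real \<Rightarrow> real"
  assumes mult: "\<And>s t. s \<ge> 0 \<Longrightarrow> t \<ge> 0 \<Longrightarrow> g (s + t) = g s * g t"
    and le1: "\<And>t. t \<ge> 0 \<Longrightarrow> g t \<le> 1" and g0: "g 0 = 1"
  obtains "\<And>t. t > 0 \<Longrightarrow> g t = 0" | c where "\<And>t. t \<ge> 0 \<Longrightarrow> g t = exp (- (c * t))"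
proof (cases "\<exists>t0>0. g t0 = 0")
  case True
  then obtain t0 where t0: "t0 > 0" "g t0 = 0" by blast
  \<comment> \<open>A zero spreads by halving to arbitrarily small arguments, and from any zero to
    everything to its right.\<close>
  have zero: "g (t0 / 2 ^ n) = 0" for n
  proof (induction n)
    case (Suc n)
    then show ?case
      using mult[of "t0 / 2 ^ Suc n" "t0 / 2 ^ Suc n"] t0 by simp
  qed (simp add: t0)
  have "g t = 0" if t: "t > 0" for t
  proof -
    obtain n where "(1 / 2) ^ n < t / t0"
      using real_arch_pow_inv[of "t / t0" "1 / 2"] t t0 by auto
    then have "t0 / 2 ^ n < t"
      using t0 by (simp add: field_simps power_divide)
    then show ?thesis
      using mult[of "t - t0 / 2 ^ n" "t0 / 2 ^ n"] zero[of n] t0 by simp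
  qed
  then show ?thesis
    by (rule that(1))
next
  case False
  have pos: "g t > 0" if "t \<ge> 0" for t
  proof -
    have "g t = (g (t / 2))\<^sup>2"
      using mult[of "t / 2" "t / 2"] that by (simp add: power2_eq_square)
    then show ?thesis
      using False g0 that by (cases "t = 0") (auto simp: zero_less_power2)
  qed
  define f where "f t = ln (g t)" for t
  have add: "f (s + t) = f s + f t" if "s \<ge> 0" "t \<ge> 0" for s t
    using that pos[of s] pos[of t] by (simp add: f_def mult ln_mult)
  have f_le: "f t \<le> 0" if "t \<ge> 0" for t
    using that le1 pos by (simp add: f_def)
  have f_nat: "f (real n * t) = real n * f t" if "t \<ge> 0" for n t
  proof (induction n)
    case (Suc n)
    then show ?case
      using add[of "real n * t" t] that by (simp add: algebra_simps)
  qed (simp add: f_def g0)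
  have "f t = t * f 1" if t: "t \<ge> 0" for t
  proof -
    \<comment> \<open>Boundedness does the work of continuity. Split n t = m + r with r in [0, 1];
      as \<open>f\<close> is additive and nonpositive, it lies between \<open>f 1\<close> and 0 on
      [0, 1], so the error stays bounded as n grows.\<close>
    have "real n * \<bar>f t - t * f 1\<bar> \<le> 2 * \<bar>f 1\<bar>" for n
    proof -
      define m where "m = nat \<lfloor>real n * t\<rfloor>"
      define r where "r = real n * t - real m"
      have r: "0 \<le> r" "r \<le> 1"
        unfolding r_def m_def using t by (simp_all add: of_nat_nat) linarith
      have "real n * f t = real m * f 1 + f r"
        using f_nat[OF t, of n] f_nat[of 1 m] add[of "real m" r] r by (simp add: r_def)
      then have "real n * (f t - t * f 1) = f r - r * f 1"
        by (simp add: r_def algebra_simps)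
      moreover have "f 1 \<le> f r" "f r \<le> 0"
        using add[of r "1 - r"] f_le[of "1 - r"] f_le[of r] r by auto
      moreover have "\<bar>r * f 1\<bar> \<le> \<bar>f 1\<bar>"
        using r by (simp add: abs_mult mult_left_le_one_le)
      ultimately have "\<bar>real n * (f t - t * f 1)\<bar> \<le> 2 * \<bar>f 1\<bar>"
        by linarith
      then show ?thesis
        by (simp add: abs_mult)
    qed
    then have "\<bar>f t - t * f 1\<bar> = 0"
      by (intro real_archimedian_rdiv_eq_0[where c = "2 * \<bar>f 1\<bar>"]) auto
    then show ?thesis by simp
  qed
  then have "g t = exp (- (- f 1 * t))" if "t \<ge> 0" for t
    using that pos[OF that] by (metis exp_ln f_def minus_minus mult.commute mult_minus_left)
  then show ?thesis
    by (rule that(2))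
qed

text \<open>Regularity comes out rather than going in: the two alternatives are discontinuity and
  continuity of \<open>G\<close> at 0.\<close>

lemma rotation_invariant_dichotomy:
  fixes G :: "complex \<Rightarrow> complex"
  assumes G0: "G 0 = 1"
    and phase: "\<And>u z. cmod u = 1 \<Longrightarrow> G (u * z) = G z"
    and rotate: "\<And>t z. G z = G (of_real (cos t) * z) * G (of_real (sin t) * z)"
    and real: "\<And>z. G z \<in> \<real>" and le1: "\<And>z. Re (G z) \<le> 1"
  obtains "G = indicator {0}" | c where "\<And>z. G z = of_real (exp (- (c * (cmod z)\<^sup>2)))"
proof -
  define g where "g t = Re (G (of_real (sqrt t)))" for t
  have G_eq: "G z = of_real (g ((cmod z)\<^sup>2))" for z
  proof -
    have "G z = G (of_real (cmod z))"
    proof (cases "z = 0")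
      case False
      then have "G (of_real (cmod z) / z * z) = G z"
        by (intro phase) (simp add: norm_divide)
      with False show ?thesis by simp
    qed simp
    then show ?thesis
      using real[of z] by (simp add: g_def)
  qed
  have mult: "g (s + t) = g s * g t" if st: "s \<ge> 0" "t \<ge> 0" for s t
  proof (cases "s + t = 0")
    case True
    with st have "s = 0" "t = 0" by auto
    then show ?thesis by (simp add: g_def G0)
  next
    case False
    \<comment> \<open>The angle is chosen so that rotating the radius sqrt (s + t) has the
      coordinates sqrt s and sqrt t.\<close>
    have "(sqrt (s / (s + t)))\<^sup>2 + (sqrt (t / (s + t)))\<^sup>2 = 1"
      using st False by (simp flip: add_divide_distrib)
    then obtain \<theta> where "sqrt (s / (s + t)) = cos \<theta>" "sqrt (t / (s + t)) = sin \<theta>"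
      by (rule sincos_total_2pi)
    from this[symmetric] have "cos \<theta> * sqrt (s + t) = sqrt s" "sin \<theta> * sqrt (s + t) = sqrt t"
      using st False by (simp_all add: real_sqrt_divide nonzero_divide_eq_eq)
    then have "G (of_real (sqrt (s + t))) = G (of_real (sqrt s)) * G (of_real (sqrt t))"
      using rotate[of "of_real (sqrt (s + t))" \<theta>] by (simp flip: of_real_mult)
    then have "complex_of_real (g (s + t)) = of_real (g s * g t)"
      using st by (simp add: G_eq)
    then show ?thesis
      by (simp only: of_real_eq_iff)
  qed
  have g_le1: "g t \<le> 1" and g_0: "g 0 = 1" for t
    by (simp_all add: g_def le1 G0)
  from mult g_le1 g_0 show ?thesis
  proof (rule multiplicative_bounded)
    assume "\<And>t. t > 0 \<Longrightarrow> g t = 0"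
    then have "G = indicator {0}"
      by (intro ext) (auto simp: g_0 G_eq indicator_def)
    then show ?thesis by (rule that(1))
  next
    fix c assume "\<And>t. t \<ge> 0 \<Longrightarrow> g t = exp (- (c * t))"
    then show ?thesis
      by (intro that(2)[of c]) (simp add: G_eq)
  qed
qed

section \<open>The lower bound on the variance\<close>

lemma Gaussian_CCR_state_variance:
  assumes "cstar_algebra A" and "ccr_relations A V" and "state A \<phi>"
    and gauss: "\<And>z. \<phi> (V z) = of_real (exp (- (c * (cmod z)\<^sup>2)))"
  shows "c \<ge> 1 / 2"
proof (rule ccontr)
  assume c: "\<not> c \<ge> 1 / 2"
  define h where "h t = 1 - exp (- (4 * c * t)) - 2 * exp (- (2 * c * t)) * sin t" for t
  have "h (r\<^sup>2) \<ge> 0" for r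
  proof -
    \<comment> \<open>The element \<open>\<Sum>j<4. \<i>^j W(\<i>^j r)\<close> is to leading order a multiple of the
      annihilation or creation operator, so its second moment detects the uncertainty principle.\<close>
    let ?l = "[(1, of_real r), (\<i>, \<i> * of_real r), (- 1, - of_real r), (- \<i>, - \<i> * of_real r)]"
    have euler: "exp (\<i> * (complex_of_real r * complex_of_real r)) = cis (r\<^sup>2)"
      "exp (- (\<i> * (complex_of_real r * complex_of_real r))) = cis (- (r\<^sup>2))"
      by (simp_all add: cis_conv_exp power2_eq_square)
    \<comment> \<open>The four diagonal terms give 4 and the four opposite pairs give -4 exp(-4 c
      r^2). The eight adjacent pairs, at squared distance 2 r^2 and with phases exp(i r^2) and
      exp(-i r^2), combine to -8 exp(-2 c r^2) sin(r^2).\<close>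
    have "(\<Sum>(a, x)\<leftarrow>?l. \<Sum>(b, y)\<leftarrow>?l.
        cnj a * b * exp (\<i> * of_real (symp (- x) y)) * \<phi> (V (y - x))) = of_real (4 * h (r\<^sup>2))"
      by (simp add: symp_def cinner_complex_def gauss h_def cmod_power2 euler complex_eq_iff
          algebra_simps)
    then show ?thesis
      using CCR_positive[OF assms(1-3), of ?l]
      by (metis nonneg_Reals_of_real_iff zero_le_mult_iff not_numeral_less_zero zero_less_numeral
         mult_less_0_iff not_le)
  qed
  then have h: "h t \<ge> 0" if "t > 0" for t
    using that by (metis less_eq_real_def real_sqrt_pow2)
  \<comment> \<open>Since \<open>h 0 = 0\<close>, the sign of \<open>h\<close> just right of 0 is
    governed by its slope: 4 c from the first exponential, -2 from the sine.\<close>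
  have "(h has_real_derivative 4 * c - 2) (at 0)"
    unfolding h_def by (auto intro!: derivative_eq_intros)
  then obtain d where "d > 0" "\<And>t. 0 < t \<Longrightarrow> t < d \<Longrightarrow> h t < h 0"
    using DERIV_neg_dec_right[of h "4 * c - 2" 0] c by auto
  from this(2)[of "d / 2"] this(1) have "h (d / 2) < 0"
    by (simp add: h_def)
  with h[of "d / 2"] \<open>d > 0\<close> show False by simp
qed

section \<open>Invariance turned into functional equations for \<open>G\<close>\<close>

theorem proposition3p12:
  fixes A :: "'a cstar_struct" and V :: "complex \<Rightarrow> 'a"
    and B :: "'b cstar_struct" and W :: "'h::complex_hilbert \<Rightarrow> 'b"
    and e :: "int \<Rightarrow> 'h"
    and \<iota> :: "int \<Rightarrow> 'a \<Rightarrow> 'b"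
    and \<rho> :: "('h \<Rightarrow> 'h) \<Rightarrow> 'b \<Rightarrow> 'b"
    and \<phi> :: "'a \<Rightarrow> complex" and \<omega> :: "'b \<Rightarrow> complex"
  assumes basis: "orthonormal_basis e"
    and CCR_A: "is_CCR A V"
    and CCR_B: "is_CCR B W"
    and embeddings: "\<And>k. site_embedding A V B W e k (\<iota> k)"
    and action: "\<And>U. U \<in> finite_unitaries e \<Longrightarrow> second_quantised B W e U (\<rho> U)"
    and state_\<phi>: "state A \<phi>"
    and product: "product_state A (local_alg B W e) \<iota> \<phi> \<omega>"
    and invariant: "\<And>U b. U \<in> finite_unitaries e \<Longrightarrow> b \<in> carrier (local_alg B W e) \<Longrightarrow>
           \<omega> (\<rho> U b) = \<omega> b"
  shows "(\<lambda>z. \<phi> (V z)) = indicator {0} \<or>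
    (\<exists>s::real. s\<^sup>2 \<ge> 1 \<and>
      (\<forall>z. \<phi> (V z) = complex_of_real (exp (- (s\<^sup>2 * (cmod z)\<^sup>2 / 2)))))"
proof -
  interpret B: cstar_algebra B
    using CCR_B by (simp add: is_CCR_def)
  have cstar_A: "cstar_algebra A" and rel_A: "ccr_relations A V"
    using CCR_A by (auto simp: is_CCR_def)
  have V_cl: "V z \<in> carrier A" for z
    using rel_A by (auto simp: ccr_relations_def)
  have W_cl: "W x \<in> carrier B"
    and W_mult: "W x \<otimes>\<^bsub>B\<^esub> W y = exp (\<i> * of_real (symp x y)) \<odot>\<^bsub>B\<^esub> W (x + y)" for x y
    using CCR_B by (auto simp: is_CCR_def ccr_relations_def)
  have ee: "cinner (e j) (e k) = (if j = k then 1 else 0)" for j k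
    using basis by (simp add: orthonormal_basis_def)
  have \<iota>_V: "\<iota> k (V z) = W (z *\<^sub>C e k)" for k z
    using embeddings by (simp add: site_embedding_def)
  define G where "G z = \<phi> (V z)" for z
  \<comment> \<open>Orthogonality of \<open>e 0\<close> and \<open>e 1\<close> makes the symplectic
    form vanish, so the Weyl element factorises over the two sites without a phase.\<close>
  have \<omega>_W: "\<omega> (W (z *\<^sub>C e 0 + w *\<^sub>C e 1)) = G z * G w" for z w
  proof -
    have "\<omega> (W (z *\<^sub>C e 0) \<otimes>\<^bsub>B\<^esub> (W (w *\<^sub>C e 1) \<otimes>\<^bsub>B\<^esub> \<one>\<^bsub>B\<^esub>)) = G z * G w"
      using product[unfolded product_state_def, THEN conjunct2, rule_format,
          of "[0, 1]" "\<lambda>k. if k = 0 then V z else V w"]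
      by (simp add: V_cl \<iota>_V local_alg_def G_def)
    moreover have "symp (z *\<^sub>C e 0) (w *\<^sub>C e 1) = 0"
      by (simp add: symp_def cinner_scaleC_left cinner_scaleC_right ee)
    ultimately show ?thesis
      by (simp add: W_cl W_mult B.scal_one)
  qed
  have G0: "G 0 = 1"
    using CCR_unit[OF CCR_A] state_\<phi> by (simp add: G_def state_def)
  \<comment> \<open>Common source of \<open>phase\<close> and \<open>rotate\<close>: as
    \<open>f\<close> lies in the span of \<open>e 0\<close> and \<open>e 1\<close>, the reflection
    fixes all \<open>e i\<close> with |i| > 1 and is in the group with bound 1.\<close>
  have reflect: "\<omega> (W (reflection u f (z *\<^sub>C e 0))) = G z"
    if u: "cmod u = 1" and f: "f = complex_of_real a *\<^sub>C e 0 + complex_of_real b *\<^sub>C e 1"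
      and ab: "a\<^sup>2 + b\<^sup>2 = 1" for u f a b z
  proof -
    have "cinner f f = of_real (a\<^sup>2 + b\<^sup>2)"
      by (simp add: f cinner_add_left cinner_add_right cinner_scaleC_left cinner_scaleC_right ee
          power2_eq_square)
    then have "unitary_op (reflection u f)"
      using u ab by (simp add: unitary_reflection)
    moreover have "reflection u f (e i) = e i" if "\<bar>i\<bar> > 1" for i
    proof -
      have "cinner (e i) f = 0"
        using that by (auto simp: f cinner_add_right cinner_scaleC_right ee)
      then show ?thesis by (simp add: reflection_def)
    qed
    ultimately have U: "reflection u f \<in> finite_unitaries e"
      unfolding finite_unitaries_def by (intro CollectI conjI exI[of _ 1]) auto
    have span: "z *\<^sub>C e 0 \<in> complex_vector.span (range e)"
      by (intro complex_vector.span_scale complex_vector.span_base) auto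
    then have "W (z *\<^sub>C e 0) \<in> carrier (local_alg B W e)"
      by (auto simp: local_alg_def cstar_generated_def)
    with invariant[OF U] action[OF U] span
    have "\<omega> (W (reflection u f (z *\<^sub>C e 0))) = \<omega> (W (z *\<^sub>C e 0))"
      by (metis second_quantised_def)
    also have "\<dots> = G z"
      using \<omega>_W[of z 0] by (simp add: G0)
    finally show ?thesis .
  qed
  have phase: "G (u * z) = G z" if "cmod u = 1" for u z
  proof -
    have "reflection u (e 0) (z *\<^sub>C e 0) = (z + (u - 1) * z) *\<^sub>C e 0"
      by (simp only: reflection_def cinner_scaleC_left ee scaleC_add_left) simp
    also have "z + (u - 1) * z = u * z"
      by (simp add: algebra_simps)
    finally show ?thesis
      using reflect[OF that, of "e 0" 1 0 z] \<omega>_W[of "u * z" 0] by (simp add: G0)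
  qed
  have rotate: "G z = G (of_real (cos t) * z) * G (of_real (sin t) * z)" for t z
  proof -
    \<comment> \<open>Half angles give the unit normal of the mirror that carries \<open>e 0\<close>
      to cos t \<open>e 0\<close> + sin t \<open>e 1\<close>.\<close>
    define a b where "a = sin (t / 2)" and "b = - cos (t / 2)"
    define f where "f = complex_of_real a *\<^sub>C e 0 + complex_of_real b *\<^sub>C e 1"
    have ct: "cos t = 1 - 2 * a * a" and st: "sin t = - 2 * a * b"
      using cos_double_sin[of "t / 2"] sin_double[of "t / 2"]
      by (simp_all add: a_def b_def power2_eq_square)
    have "cinner (z *\<^sub>C e 0) f = z * of_real a"
      by (simp add: f_def cinner_scaleC_left cinner_scaleC_right cinner_add_right ee)
    then have "reflection (- 1) f (z *\<^sub>C e 0) =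
        z *\<^sub>C e 0 + ((- 2 * (z * of_real a) * of_real a) *\<^sub>C e 0 +
          (- 2 * (z * of_real a) * of_real b) *\<^sub>C e 1)"
      by (simp add: reflection_def f_def scaleC_add_right scaleC_scaleC)
    also have "\<dots> = (z + - 2 * (z * of_real a) * of_real a) *\<^sub>C e 0 +
          (- 2 * (z * of_real a) * of_real b) *\<^sub>C e 1"
      by (simp only: scaleC_add_left add.assoc)
    also have "z + - 2 * (z * of_real a) * of_real a = of_real (cos t) * z"
      by (simp add: ct algebra_simps)
    also have "- 2 * (z * of_real a) * of_real b = of_real (sin t) * z"
      by (simp add: st algebra_simps)
    finally show ?thesis
      using reflect[OF _ f_def, of "- 1" z] by (simp add: \<omega>_W a_def b_def)
  qed
  have real_bound: "G z \<in> \<real> \<and> Re (G z) \<le> 1" for z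
  proof -
    have zero: "symp 0 x = 0" "symp x 0 = 0" "symp (- x) x = 0" "symp x x = 0" for x :: complex
      by (simp_all add: symp_def cinner_complex_def)
    \<comment> \<open>Positivity for 1 - W(z) gives 2 - G(z) - G(-z), and \<open>G\<close> is even
      by the phase -1. This one membership yields both reality and the bound.\<close>
    have "2 - 2 * G z \<in> \<real>\<^sub>\<ge>\<^sub>0"
      using CCR_positive[OF cstar_A rel_A state_\<phi>, of "[(1, 0), (- 1, z)]"] phase[of "- 1" z]
      by (simp add: zero G0 flip: G_def)
    then show ?thesis
      by (simp add: complex_nonneg_Reals_iff complex_is_Real_iff)
  qed
  consider "G = indicator {0}" | c where "\<And>z. G z = of_real (exp (- (c * (cmod z)\<^sup>2)))"
    using rotation_invariant_dichotomy[OF G0 phase rotate] real_bound by metis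
  then show ?thesis
  proof cases
    case 1
    then show ?thesis by (auto simp: fun_eq_iff G_def)
  next
    case 2
    then have "c \<ge> 1 / 2"
      using Gaussian_CCR_state_variance[OF cstar_A rel_A state_\<phi>] by (simp add: G_def)
    \<comment> \<open>Matching exponents forces s^2 = 2 c, and \<open>c \<ge> 1 / 2\<close> is then
      s^2 \<ge> 1.\<close>
    with 2 show ?thesis
      by (intro disjI2 exI[of _ "sqrt (2 * c)"]) (simp add: G_def)
  qed
qed

end
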